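(* Let $\Omega\subset\mathbb{R}^2$ be a bounded polygonal domain with a triangular mesh having vertices $(x_i,y_i)$, $i\in I\cup B$, where $I$ indexes the $m$ interior vertices and $B$ indexes the $b$ boundary vertices. Let $A_I$ ($m\times m$) and $A_B$ ($m\times b$) be the submatrices of the piecewise linear finite element stiffness matrix of the Laplacian on this mesh generated by FEMWARP (defined in the context). Then $A_I$ is nonsingular. Let $(\hat x_j,\hat y_j)$, $j\in B$, be prescribed deformed coordinates of the boundary vertices, and suppose there exist a nonsingular matrix $L\in\mathbb{R}^{2\times 2}$ and a vector $v\in\mathbb{R}^2$ such that for each $j\in B$, $$\begin{pmatrix}\hat x_j\\ \hat y_j\end{pmatrix}=L\begin{pmatrix}x_j\\ y_j\end{pmatrix}+v .$$ Let $[\hat x_I,\hat y_I]\in\mathbb{R}^{m\times 2}$ be the deformed interior coordinates computed by FEMWARP, i.e., the solution of $$A_I[\hat x_I,\hat y_I]=-A_B[\hat x_B,\hat y_B].$$ Then for each $i\in I$, $$\begin{pmatrix}\hat x_i\\ \hat y_i\end{pmatrix}=L\begin{pmatrix}x_i\\ y_i\end{pmatrix}+v .$$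
   Context: The mesh is a conforming triangulation of $\Omega$ by nondegenerate triangles; boundary vertices are the mesh vertices lying on $\partial\Omega$, and interior vertices are the remaining ones. For each vertex $p_i=(x_i,y_i)$, $i=1,\dots,m+b$, let $\phi_i$ be the continuous function on $\Omega$ that is affine on each triangle of the mesh with $\phi_i(p_i)=1$ and $\phi_i(p_j)=0$ for every other vertex $p_j$, $j\ne i$. The stiffness matrix is the $(m+b)\times(m+b)$ matrix $$A(i,j)=\int_\Omega \nabla\phi_i\cdot\nabla\phi_j .$$ $A_I$ is the submatrix of $A$ with rows and columns indexed by interior vertices; $A_B$ is the submatrix with rows indexed by interior vertices and columns indexed by boundary vertices. $\hat x_I,\hat y_I$ (respectively $\hat x_B,\hat y_B$) denote the column vectors of the deformed $x$- and $y$-coordinates of the interior (respectively boundary) vertices, and $[\cdot,\cdot]$ denotes the matrix with the two given columns. FEMWARP: given the original mesh and the prescribed new boundary vertex positions $[\hat x_B,\hat y_B]$, form $A_I$ and $A_B$ from the original mesh and solve $A_I[\hat x_I,\hat y_I]=-A_B[\hat x_B,\hat y_B]$ for the new interior vertex positions. *)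

theory Defs
  imports "HOL-Analysis.Analysis" "Jordan_Normal_Form.DL_Submatrix"
begin

section \<open>Polygonal domains and triangular meshes\<close>

definition bounded_polygonal_domain :: "(real^2) set \<Rightarrow> bool" where
  "bounded_polygonal_domain \<Omega> \<longleftrightarrow>
     open \<Omega> \<and> connected \<Omega> \<and> \<Omega> \<noteq> {} \<and> bounded \<Omega> \<and>
     (\<exists>E. finite E \<and> (\<forall>(a, b)\<in>E. a \<noteq> b) \<and> frontier \<Omega> = (\<Union>(a, b)\<in>E. closed_segment a b))"

text \<open>
  A library \<^const>\<open>triangulation\<close> is finite, and any two of its members meet in a common
  (possibly empty) face, which is conformity; a 2-simplex is a nondegenerate closed triangle.
\<close>

definition triangular_mesh :: "(real^2) set \<Rightarrow> (real^2) set set \<Rightarrow> bool" where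
  "triangular_mesh \<Omega> \<T> \<longleftrightarrow>
     triangulation \<T> \<and> (\<forall>T\<in>\<T>. 2 simplex T) \<and> \<Union>\<T> = closure \<Omega>"

definition mesh_vertices :: "(real^2) set set \<Rightarrow> (real^2) set" where
  "mesh_vertices \<T> = {w. \<exists>T\<in>\<T>. w extreme_point_of T}"

section \<open>Piecewise linear finite elements\<close>

definition is_hat_function :: "(real^2) set set \<Rightarrow> real^2 \<Rightarrow> (real^2 \<Rightarrow> real) \<Rightarrow> bool" where
  "is_hat_function \<T> w \<phi> \<longleftrightarrow>
     continuous_on (\<Union>\<T>) \<phi> \<and>
     (\<forall>T\<in>\<T>. \<exists>g c. linear g \<and> (\<forall>x\<in>T. \<phi> x = g x + c)) \<and>
     \<phi> w = 1 \<and> (\<forall>u\<in>mesh_vertices \<T> - {w}. \<phi> u = 0)"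

text \<open>
  The conditions fix the function on the union of the triangles only. Its values elsewhere are
  arbitrary and do not enter the stiffness matrix, which integrates over an open set contained
  in that union.
\<close>

definition hat_function :: "(real^2) set set \<Rightarrow> real^2 \<Rightarrow> real^2 \<Rightarrow> real" where
  "hat_function \<T> w = (SOME \<phi>. is_hat_function \<T> w \<phi>)"

text \<open>
  Unspecified where \<open>f\<close> is not differentiable; for a hat function this can only happen, within
  the domain, on the null set formed by the edges of the mesh.
\<close>

definition grad :: "(real^2 \<Rightarrow> real) \<Rightarrow> real^2 \<Rightarrow> real^2" where
  "grad f x = (THE D. GDERIV f x :> D)"

text \<open>The vertices are numbered \<open>p 0, \<dots>, p (n - 1)\<close>, interior and boundary ones in any order.\<close>

definition stiffness_matrix ::
  "(real^2) set \<Rightarrow> (real^2) set set \<Rightarrow> nat \<Rightarrow> (nat \<Rightarrow> real^2) \<Rightarrow> real Matrix.mat" where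
  "stiffness_matrix \<Omega> \<T> n p =
     Matrix.mat n n (\<lambda>(i, j).
       integral \<Omega> (\<lambda>x. grad (hat_function \<T> (p i)) x \<bullet> grad (hat_function \<T> (p j)) x))"

section \<open>FEMWARP\<close>

definition interior_indices :: "(real^2) set \<Rightarrow> nat \<Rightarrow> (nat \<Rightarrow> real^2) \<Rightarrow> nat set" where
  "interior_indices \<Omega> n p = {i. i < n \<and> p i \<notin> frontier \<Omega>}"

definition boundary_indices :: "(real^2) set \<Rightarrow> nat \<Rightarrow> (nat \<Rightarrow> real^2) \<Rightarrow> nat set" where
  "boundary_indices \<Omega> n p = {i. i < n \<and> p i \<in> frontier \<Omega>}"

definition A_I ::
  "(real^2) set \<Rightarrow> (real^2) set set \<Rightarrow> nat \<Rightarrow> (nat \<Rightarrow> real^2) \<Rightarrow> real Matrix.mat" where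
  "A_I \<Omega> \<T> n p =
     submatrix (stiffness_matrix \<Omega> \<T> n p) (interior_indices \<Omega> n p) (interior_indices \<Omega> n p)"

definition A_B ::
  "(real^2) set \<Rightarrow> (real^2) set set \<Rightarrow> nat \<Rightarrow> (nat \<Rightarrow> real^2) \<Rightarrow> real Matrix.mat" where
  "A_B \<Omega> \<T> n p =
     submatrix (stiffness_matrix \<Omega> \<T> n p) (interior_indices \<Omega> n p) (boundary_indices \<Omega> n p)"

text \<open>
  The matrix with the two columns of \<open>x\<close>- and \<open>y\<close>-coordinates of the points \<open>q i\<close>, \<open>i \<in> J\<close>, its
  rows being in increasing order of \<open>i\<close>, the order in which \<^const>\<open>submatrix\<close> takes rows and columns.
\<close>

definition coordinate_matrix :: "nat \<Rightarrow> (nat \<Rightarrow> real^2) \<Rightarrow> nat set \<Rightarrow> real Matrix.mat" where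
  "coordinate_matrix n q J =
     submatrix (Matrix.mat n 2 (\<lambda>(i, k). if k = 0 then vec_nth (q i) 1 else vec_nth (q i) 2)) J UNIV"

text \<open>
  The positions \<open>q\<close> solve the FEMWARP system, given their values at the boundary indices.
\<close>

definition femwarp_solution ::
  "(real^2) set \<Rightarrow> (real^2) set set \<Rightarrow> nat \<Rightarrow> (nat \<Rightarrow> real^2) \<Rightarrow> (nat \<Rightarrow> real^2) \<Rightarrow> bool" where
  "femwarp_solution \<Omega> \<T> n p q \<longleftrightarrow>
     A_I \<Omega> \<T> n p * coordinate_matrix n q (interior_indices \<Omega> n p) =
       - (A_B \<Omega> \<T> n p) * coordinate_matrix n q (boundary_indices \<Omega> n p)"

end

theory Submission
  imports Defs "Jordan_Normal_Form.Determinant"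
begin

text \<open>
  The argument rests on two facts about the stiffness matrix \<open>A\<close>, whose entries reduce to finite sums
  over the triangles since the gradients of hat functions are constant on each triangle.

  The interior block is positive definite. For \<open>f = (\<Sum>i\<in>I. c i * \<phi> i)\<close>, its quadratic form at \<open>c\<close>
  is the Dirichlet energy of \<open>f\<close>. If this is zero, \<open>f\<close> is constant on every triangle, hence constant on
  the connected closure of the domain, and it vanishes at a boundary vertex, which exists because an
  extreme vertex of the mesh cannot be an interior point. So \<open>c = 0\<close> (\<open>stiffness_definite\<close>,
  \<open>ex_boundary_vertex\<close>).

  Affine functions are discretely harmonic: if \<open>g\<close> is affine, then \<open>(\<Sum>j. A(i, j) * g (p j)) = 0\<close>
  at every interior vertex \<open>p i\<close> (\<open>stiffness_affine\<close>). Indeed \<open>g\<close> is the combination of the hat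
  functions with coefficients \<open>g (p j)\<close>, so the sum is the inner product of the constant gradient of
  \<open>g\<close> with the integral of the gradient of \<open>\<phi> i\<close>. That integral is zero
  (\<open>sum_elem_grad_interior_vertex\<close>): extended by zero, \<open>\<phi> i\<close> is a Lipschitz function of bounded
  support on the whole plane, and the integral of a directional derivative of such a function vanishes
  by translation invariance (\<open>integral_directional_derivative_eq_0\<close>). The delicate point is
  that the extension is continuous: the open star of an interior vertex has to be open in the plane
  (\<open>hat_pos_imp_interior\<close>).

  Each coordinate of \<open>x \<mapsto> L x + v\<close> is affine, so the images of the interior vertices solve the linear
  system with the images of the boundary vertices as data. By the first fact, there is no other solution.
\<close>

section \<open>Affine functions\<close>

(* From here on, the two symbols mean the inner product and the components of points of the plane. *)
no_notation scalar_prod (infix "\<bullet>" 70)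
no_notation vec_index (infixl "$" 100)

text \<open>
  The set where two affine functions agree is a hyperplane, empty or everything, so it is convex;
  hence an affine function on a triangle is determined by its values at the corners.
\<close>

lemma affine_eq_on_convex_hull:
  fixes a a' :: "'a::euclidean_space"
  assumes "\<And>v. v \<in> C \<Longrightarrow> a \<bullet> v + c = a' \<bullet> v + c'" and "x \<in> convex hull C"
  shows "a \<bullet> x + c = a' \<bullet> x + c'"
proof -
  have "{x. a \<bullet> x + c = a' \<bullet> x + c'} = {x. (a - a') \<bullet> x = c' - c}"
    by (auto simp: inner_diff_left)
  then have "convex {x. a \<bullet> x + c = a' \<bullet> x + c'}"
    by (simp add: convex_hyperplane)
  with assms have "convex hull C \<subseteq> {x. a \<bullet> x + c = a' \<bullet> x + c'}"
    by (intro hull_minimal) auto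
  with assms show ?thesis by auto
qed

lemma affine_gradient_unique:
  fixes a a' :: "'a::euclidean_space"
  assumes "interior T \<noteq> {}" and eq: "\<And>x. x \<in> T \<Longrightarrow> a \<bullet> x + c = a' \<bullet> x + c'"
  shows "a = a'"
proof -
  obtain z where z: "z \<in> interior T" using assms(1) by auto
  have "((\<lambda>x. a \<bullet> x + c) has_derivative (\<lambda>h. a \<bullet> h)) (at z)"
    by (auto intro!: derivative_eq_intros)
  moreover have "((\<lambda>x. a' \<bullet> x + c') has_derivative (\<lambda>h. a' \<bullet> h)) (at z)"
    by (auto intro!: derivative_eq_intros)
  then have "((\<lambda>x. a \<bullet> x + c) has_derivative (\<lambda>h. a' \<bullet> h)) (at z)"
    by (rule has_derivative_transform_within_open[OF _ open_interior z])
      (use eq interior_subset in fastforce)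
  ultimately have "(\<lambda>h. a \<bullet> h) = (\<lambda>h. a' \<bullet> h)"
    by (rule has_derivative_unique)
  then show ?thesis by (metis vector_eq_rdot)
qed

lemma linear_functional_inner:
  fixes g :: "'a::euclidean_space \<Rightarrow> real"
  assumes "linear g"
  obtains a where "\<And>x. g x = a \<bullet> x"
  using adjoint_works[OF assms, of _ 1] by (metis inner_commute inner_real_def mult.right_neutral)

text \<open>
  After a translation that takes one of the points to the origin, the differences to the other
  points are linearly independent, and a linear map may be prescribed on them.
\<close>

lemma affine_interpolation:
  fixes C :: "'a::euclidean_space set"
  assumes "\<not> affine_dependent C"
  obtains a c where "\<And>v. v \<in> C \<Longrightarrow> a \<bullet> v + c = f v"
proof (cases "C = {}")
  case False
  then obtain v0 where v0: "v0 \<in> C" by auto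
  let ?B = "(\<lambda>x. -v0 + x) ` (C - {v0})"
  have "independent ?B"
    using assms affine_dependent_iff_dependent2[OF v0] by simp
  then obtain g where g: "linear g" "\<forall>b\<in>?B. g b = f (v0 + b) - f v0"
    using linear_independent_extend[of ?B "\<lambda>b. f (v0 + b) - f v0"] by blast
  obtain a where a: "\<And>x. g x = a \<bullet> x"
    using linear_functional_inner[OF g(1)] by blast
  have "a \<bullet> v + (f v0 - a \<bullet> v0) = f v" if "v \<in> C" for v
  proof (cases "v = v0")
    case False
    then have "g (-v0 + v) = f v - f v0"
      using g(2)[rule_format, of "-v0 + v"] that by auto
    then show ?thesis by (simp add: a inner_diff_right)
  qed simp
  then show ?thesis using that by blast
qed (use that in auto)

section \<open>Lipschitz functions of bounded support\<close>

text \<open>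
  This stands in for the divergence theorem. Every difference quotient of \<^term>\<open>\<Phi>\<close> integrates
  to zero, because Lebesgue measure is invariant under translations. The quotients are bounded by
  the Lipschitz constant and vanish outside one ball, so the limit may be taken under the integral.
\<close>

lemma integral_directional_derivative_eq_0:
  fixes \<Phi> D :: "'a::euclidean_space \<Rightarrow> real"
  assumes lip: "M-lipschitz_on UNIV \<Phi>"
    and supp: "\<And>x. norm x > R \<Longrightarrow> \<Phi> x = 0"
    and [measurable]: "D \<in> borel_measurable borel"
    and deriv: "AE x in lborel. ((\<lambda>t. (\<Phi> (x + t *\<^sub>R e) - \<Phi> x) / t) \<longlongrightarrow> D x) (at 0)"
  shows "integral\<^sup>L lborel D = 0"
proof -
  have cont: "continuous_on UNIV \<Phi>"
    using lip by (rule lipschitz_on_continuous_on)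
  have [measurable]: "\<Phi> \<in> borel_measurable borel"
    using cont by (rule borel_measurable_continuous_onI)
  define h :: "nat \<Rightarrow> real" where "h k = inverse (real (Suc k))" for k
  have h: "h k > 0" "h k \<le> 1" for k by (auto simp: h_def field_simps)
  have "h \<longlonglongrightarrow> 0"
    unfolding h_def by (rule LIMSEQ_inverse_real_of_nat)
  moreover have "eventually (\<lambda>k. h k \<noteq> 0) sequentially"
    using h(1) by (simp add: less_imp_neq[THEN not_sym])
  ultimately have h0: "filterlim h (at 0) sequentially"
    by (simp add: filterlim_at)
  define q where "q k x = (\<Phi> (x + h k *\<^sub>R e) - \<Phi> x) / h k" for k x
  have [measurable]: "q k \<in> borel_measurable borel" for k
    unfolding q_def by measurable
  have int\<Phi>: "integrable lborel \<Phi>"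
  proof -
    have "integrable lborel (\<lambda>x. indicat_real (cball 0 R) x *\<^sub>R \<Phi> x)"
      by (rule borel_integrable_compact) (use cont continuous_on_subset in auto)
    moreover have "(\<lambda>x. indicat_real (cball 0 R) x *\<^sub>R \<Phi> x) = \<Phi>"
      using supp by (auto simp: fun_eq_iff indicator_def not_le)
    ultimately show ?thesis by metis
  qed
  have shift: "integrable lborel (\<lambda>x. \<Phi> (x + u))"
    "(\<integral>x. \<Phi> (x + u) \<partial>lborel) = integral\<^sup>L lborel \<Phi>" for u
  proof -
    have "integrable (distr lborel borel ((+) u)) \<Phi>"
      using int\<Phi> by (simp add: lborel_distr_plus)
    then have "integrable lborel (\<lambda>x. \<Phi> (u + x))"
      by (rule integrable_distr[rotated]) simp
    then show "integrable lborel (\<lambda>x. \<Phi> (x + u))" by (simp add: add.commute)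
    have "integral\<^sup>L (distr lborel borel ((+) u)) \<Phi> = (\<integral>x. \<Phi> (u + x) \<partial>lborel)"
      by (rule integral_distr) simp_all
    then show "(\<integral>x. \<Phi> (x + u) \<partial>lborel) = integral\<^sup>L lborel \<Phi>"
      by (simp add: lborel_distr_plus add.commute)
  qed
  have q0: "integral\<^sup>L lborel (q k) = 0" for k
    unfolding q_def using shift int\<Phi> by simp
  have bound: "norm (q k x) \<le> indicat_real (cball 0 (R + norm e)) x * (M * norm e)" for k x
  proof (cases "norm x \<le> R + norm e")
    case True
    have "\<bar>\<Phi> (x + h k *\<^sub>R e) - \<Phi> x\<bar> \<le> M * norm (h k *\<^sub>R e)"
      using lipschitz_onD[OF lip, of "x + h k *\<^sub>R e" x] by (simp add: dist_norm)
    then show ?thesis using True h(1)[of k] by (simp add: q_def field_simps abs_div)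
  next
    case False
    have "norm x \<le> norm (x + h k *\<^sub>R e) + norm (h k *\<^sub>R e)"
      by (metis add_diff_cancel_right' norm_triangle_ineq4)
    moreover have "norm (h k *\<^sub>R e) \<le> norm e"
      using h[of k] by (simp add: mult_left_le_one_le)
    ultimately have "norm (x + h k *\<^sub>R e) > R" using False by linarith
    moreover have "norm x > R" using False norm_ge_zero[of e] by linarith
    ultimately show ?thesis using lipschitz_on_nonneg[OF lip] by (simp add: q_def supp)
  qed
  have "(\<lambda>k. integral\<^sup>L lborel (q k)) \<longlonglongrightarrow> integral\<^sup>L lborel D"
  proof (rule integral_dominated_convergence[where w = "\<lambda>x. indicat_real (cball 0 (R + norm e)) x * (M * norm e)"])
    show "AE x in lborel. (\<lambda>k. q k x) \<longlonglongrightarrow> D x"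
      using deriv by eventually_elim (auto simp: q_def intro: filterlim_compose[OF _ h0])
  qed (use bound in \<open>auto intro!: integrable_mult_left integrable_real_indicator emeasure_lborel_cball_finite\<close>)
  then show ?thesis by (simp add: q0 LIMSEQ_const_iff)
qed

text \<open>
  A segment may leave a piece and enter it again, as the pieces are not assumed convex. But along
  the segment the question is about functions on an interval, where bounds with the same constant on
  finitely many closed sets chain together.
\<close>

lemma lipschitz_on_closed_cover:
  fixes f :: "'a::real_normed_vector \<Rightarrow> 'b::metric_space"
  assumes "finite \<U>" "\<Union>\<U> = UNIV" "M \<ge> 0"
    and closed: "\<And>S. S \<in> \<U> \<Longrightarrow> closed S"
    and lip: "\<And>S. S \<in> \<U> \<Longrightarrow> M-lipschitz_on S f"
  shows "M-lipschitz_on UNIV f"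
proof (rule lipschitz_onI)
  fix x y :: 'a
  define \<gamma> :: "real \<Rightarrow> 'a" where "\<gamma> t = x + t *\<^sub>R (y - x)" for t
  have cont: "continuous_on UNIV \<gamma>" unfolding \<gamma>_def by (intro continuous_intros)
  have dist_\<gamma>: "dist (\<gamma> s) (\<gamma> t) = dist x y * dist s t" for s t
    by (simp add: \<gamma>_def dist_norm norm_minus_commute flip: scaleR_left_diff_distrib)
  have "(M * dist x y)-lipschitz_on {0..1} (\<lambda>t. f (\<gamma> t))"
  proof (rule lipschitz_on_closed_Union)
    fix S assume S: "S \<in> \<U>"
    show "closed (\<gamma> -` S)"
      using cont closed[OF S]
      by (simp add: closed_vimage continuous_on_eq_continuous_at continuous_at_imp_continuous_on)
    show "(M * dist x y)-lipschitz_on (\<gamma> -` S) (\<lambda>t. f (\<gamma> t))"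
    proof (rule lipschitz_onI)
      fix s t assume "s \<in> \<gamma> -` S" "t \<in> \<gamma> -` S"
      then show "dist (f (\<gamma> s)) (f (\<gamma> t)) \<le> M * dist x y * dist s t"
        using lipschitz_onD[OF lip[OF S], of "\<gamma> s" "\<gamma> t"] by (simp add: dist_\<gamma> mult.assoc)
    qed (use \<open>M \<ge> 0\<close> in simp)
  next
    show "{0..1} \<subseteq> (\<Union>S\<in>\<U>. \<gamma> -` S)"
    proof
      fix t
      have "\<gamma> t \<in> \<Union>\<U>" using assms(2) by simp
      then show "t \<in> (\<Union>S\<in>\<U>. \<gamma> -` S)" by blast
    qed
  qed (use assms in auto)
  from lipschitz_onD[OF this, of 0 1] show "dist (f x) (f y) \<le> M * dist x y"
    by (simp add: \<gamma>_def)
qed fact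

lemma affine_directional_derivative:
  fixes f :: "'a::euclidean_space \<Rightarrow> real"
  assumes "open S" "x \<in> S" and f: "\<And>y. y \<in> S \<Longrightarrow> f y = a \<bullet> y + c"
  shows "((\<lambda>t. (f (x + t *\<^sub>R e) - f x) / t) \<longlongrightarrow> a \<bullet> e) (at 0)"
proof (rule tendsto_eventually)
  have "((\<lambda>t. x + t *\<^sub>R e) \<longlongrightarrow> x + 0 *\<^sub>R e) (at 0)"
    by (intro tendsto_intros)
  then have "eventually (\<lambda>t. x + t *\<^sub>R e \<in> S) (at 0)"
    using assms(1,2) by (auto dest: topological_tendstoD)
  moreover have "eventually (\<lambda>t. t \<noteq> (0::real)) (at 0)"
    by (simp add: eventually_at_filter)
  ultimately show "eventually (\<lambda>t. (f (x + t *\<^sub>R e) - f x) / t = a \<bullet> e) (at 0)"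
    by eventually_elim (simp add: f assms(2) inner_add_right)
qed

section \<open>Triangles, corners and vertices\<close>

locale triangulated_region =
  fixes \<T> :: "(real^2) set set"
  assumes triangulation: "triangulation \<T>"
    and triangles: "\<And>T. T \<in> \<T> \<Longrightarrow> 2 simplex T"
begin

lemma finite_triangles [simp]: "finite \<T>"
  using triangulation by (simp add: triangulation_def)

lemma triangle_facts:
  assumes "T \<in> \<T>"
  shows finite_corners: "finite {w. w extreme_point_of T}"
    and corners_independent: "\<not> affine_dependent {w. w extreme_point_of T}"
    and triangle_hull: "T = convex hull {w. w extreme_point_of T}"
    and compact_triangle: "compact T"
    and convex_triangle: "convex T"
    and interior_triangle: "interior T \<noteq> {}"
proof -
  obtain C where C: "\<not> affine_dependent C" "int (card C) = 2 + 1" "T = convex hull C"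
    using triangles[OF assms] by (auto simp: simplex_def)
  have corners: "{w. w extreme_point_of T} = C"
    using extreme_point_of_convex_hull_affine_independent[OF C(1)] C(3) by auto
  have fin: "finite C" using C(1) by (rule aff_independent_finite)
  show "finite {w. w extreme_point_of T}" "\<not> affine_dependent {w. w extreme_point_of T}"
    "T = convex hull {w. w extreme_point_of T}"
    using corners fin C by auto
  show "compact T" "convex T" using C(3) fin by (auto simp: finite_imp_compact_convex_hull)
  have "aff_dim T = 2"
    using C aff_dim_affine_independent[OF C(1)] by (simp add: aff_dim_convex_hull)
  then have "affine hull T = UNIV" "T \<noteq> {}"
    by (auto simp flip: aff_dim_eq_full)
  then show "interior T \<noteq> {}"
    using rel_interior_eq_empty[OF \<open>convex T\<close>] rel_interior_interior by metis
qed

lemma closed_triangle: "T \<in> \<T> \<Longrightarrow> closed T"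
  by (simp add: compact_triangle compact_imp_closed)

lemma compact_region: "compact (\<Union>\<T>)"
  by (rule compact_Union) (auto simp: compact_triangle)

lemma finite_vertices [simp]: "finite (mesh_vertices \<T>)"
proof -
  have "mesh_vertices \<T> = (\<Union>T\<in>\<T>. {w. w extreme_point_of T})"
    by (auto simp: mesh_vertices_def)
  then show ?thesis by (simp add: finite_corners)
qed

lemma face_Int: "T \<in> \<T> \<Longrightarrow> T' \<in> \<T> \<Longrightarrow> T \<inter> T' face_of T"
  using triangulation by (simp add: triangulation_def)

lemma face_Int': "T \<in> \<T> \<Longrightarrow> T' \<in> \<T> \<Longrightarrow> T \<inter> T' face_of T'"
  by (metis Int_commute face_Int)

text \<open>
  Conformity rules out hanging vertices: a corner of \<^term>\<open>T'\<close> that lies in \<^term>\<open>T\<close> is an extreme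
  point of the common face of the two triangles, hence of \<^term>\<open>T\<close>.
\<close>

lemma vertex_is_corner:
  assumes "w \<in> mesh_vertices \<T>" "T \<in> \<T>" "w \<in> T"
  shows "w extreme_point_of T"
proof -
  obtain T' where T': "T' \<in> \<T>" "w extreme_point_of T'"
    using assms(1) by (auto simp: mesh_vertices_def)
  then have "w extreme_point_of (T \<inter> T')"
    using extreme_point_of_face[OF face_Int'[OF assms(2) T'(1)]] assms(3)
    by (auto simp: extreme_point_of_def)
  then show ?thesis
    using extreme_point_of_face[OF face_Int[OF assms(2) T'(1)]] by simp
qed

lemma corner_is_vertex: "T \<in> \<T> \<Longrightarrow> w extreme_point_of T \<Longrightarrow> w \<in> mesh_vertices \<T>"
  by (auto simp: mesh_vertices_def)

lemma vertex_subset_region: "mesh_vertices \<T> \<subseteq> \<Union>\<T>"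
  by (auto simp: mesh_vertices_def extreme_point_of_def)

text \<open>
  The common face of two triangles is spanned by their common corners. This is what makes affine
  functions with matching corner values fit together continuously.
\<close>

lemma triangle_Int_hull:
  assumes "T \<in> \<T>" "T' \<in> \<T>"
  shows "T \<inter> T' = convex hull {w. w extreme_point_of T \<and> w extreme_point_of T'}"
proof -
  have "T \<inter> T' = convex hull {w. w extreme_point_of (T \<inter> T')}"
    by (intro Krein_Milman_Minkowski compact_Int convex_Int compact_triangle convex_triangle assms)
  moreover have "w extreme_point_of (T \<inter> T') \<longleftrightarrow> w extreme_point_of T \<and> w extreme_point_of T'" for w
    using extreme_point_of_face[OF face_Int[OF assms], of w]
      extreme_point_of_face[OF face_Int'[OF assms], of w]
    unfolding extreme_point_of_def by blast
  ultimately show ?thesis by simp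
qed

lemma negligible_triangle_Int:
  assumes "T \<in> \<T>" "T' \<in> \<T>" "T \<noteq> T'"
  shows "negligible (T \<inter> T')"
proof -
  have "negligible F" if "F face_of S" "F \<noteq> S" "S \<in> \<T>" for F S
  proof -
    have "F \<subseteq> frontier S"
      using face_of_subset_rel_frontier[OF that(1,2)] rel_frontier_nonempty_interior[OF interior_triangle[OF that(3)]]
      by simp
    then show ?thesis
      using negligible_convex_frontier[OF convex_triangle[OF that(3)]] negligible_subset by blast
  qed
  then show ?thesis
    using face_Int[OF assms(1,2)] face_Int'[OF assms(1,2)] assms by (cases "T \<inter> T' = T") auto
qed

lemma measure_triangle_pos: "T \<in> \<T> \<Longrightarrow> measure lebesgue T > 0"
  using interior_triangle[of T] convex_triangle[of T] negligible_convex_interior[of T]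
    negligible_iff_measure0[OF lmeasurable_compact[OF compact_triangle[of T]]]
  by (auto simp: less_le)

section \<open>Hat functions and their gradients\<close>

text \<open>
  On each triangle, take the affine function with the required values at the corners. Two of these
  agree on the intersection of their triangles, because they agree at the common corners; so they
  glue to one function, which is continuous since the triangles are finitely many closed sets.
\<close>

lemma ex_hat_function:
  assumes "w \<in> mesh_vertices \<T>"
  shows "\<exists>\<phi>. is_hat_function \<T> w \<phi>"
proof -
  have "\<exists>a c. \<forall>v. v extreme_point_of T \<longrightarrow> a \<bullet> v + c = of_bool (v = w)" if "T \<in> \<T>" for T
    by (rule affine_interpolation[OF corners_independent[OF that], of "\<lambda>v. of_bool (v = w)"]) blast
  then obtain a c where ac: "\<And>T v. T \<in> \<T> \<Longrightarrow> v extreme_point_of T \<Longrightarrow> a T \<bullet> v + c T = of_bool (v = w)"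
    by metis
  define \<phi> where "\<phi> x = (let T = (SOME T. T \<in> \<T> \<and> x \<in> T) in a T \<bullet> x + c T)" for x
  have \<phi>: "\<phi> x = a T \<bullet> x + c T" if "T \<in> \<T>" "x \<in> T" for T x
  proof -
    define T' where "T' = (SOME T. T \<in> \<T> \<and> x \<in> T)"
    have T': "T' \<in> \<T>" "x \<in> T'"
      using someI[of "\<lambda>T. T \<in> \<T> \<and> x \<in> T" T] that by (auto simp: T'_def)
    have "x \<in> convex hull {w. w extreme_point_of T' \<and> w extreme_point_of T}"
      using triangle_Int_hull[OF T'(1) that(1)] that T' by auto
    then have "a T' \<bullet> x + c T' = a T \<bullet> x + c T"
      by (rule affine_eq_on_convex_hull[rotated]) (use ac T' that in auto)
    then show ?thesis by (simp add: \<phi>_def T'_def)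
  qed
  have "continuous_on (\<Union>T\<in>\<T>. T) \<phi>"
  proof (rule continuous_on_closed_Union)
    fix T assume "T \<in> \<T>"
    moreover have "continuous_on T (\<lambda>x. a T \<bullet> x + c T)" by (intro continuous_intros)
    ultimately show "continuous_on T \<phi>"
      using continuous_on_cong[of T T \<phi> "\<lambda>x. a T \<bullet> x + c T"] \<phi>[OF \<open>T \<in> \<T>\<close>] by simp
  qed (auto simp: closed_triangle)
  moreover have "\<exists>g c. linear g \<and> (\<forall>x\<in>T. \<phi> x = g x + c)" if "T \<in> \<T>" for T
    by (intro exI[of _ "\<lambda>x. a T \<bullet> x"] exI[of _ "c T"])
      (auto simp: \<phi>[OF that] bounded_linear.linear[OF bounded_linear_inner_right])
  moreover have "\<phi> u = of_bool (u = w)" if "u \<in> mesh_vertices \<T>" for u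
    using that ac \<phi> by (auto simp: mesh_vertices_def extreme_point_of_def)
  ultimately show ?thesis using assms by (auto simp: is_hat_function_def)
qed

abbreviation hat where "hat \<equiv> hat_function \<T>"

context
  fixes w assumes w: "w \<in> mesh_vertices \<T>"
begin

lemma is_hat_function_hat: "is_hat_function \<T> w (hat w)"
  unfolding hat_function_def using ex_hat_function[OF w] by (rule someI_ex)

lemma continuous_on_hat: "continuous_on (\<Union>\<T>) (hat w)"
  using is_hat_function_hat by (simp add: is_hat_function_def)

lemma hat_vertex: "u \<in> mesh_vertices \<T> \<Longrightarrow> hat w u = of_bool (u = w)"
  using is_hat_function_hat by (auto simp: is_hat_function_def)

lemma hat_affine: "T \<in> \<T> \<Longrightarrow> \<exists>a c. \<forall>x\<in>T. hat w x = a \<bullet> x + c"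
proof -
  assume "T \<in> \<T>"
  then obtain g c where g: "linear g" "\<forall>x\<in>T. hat w x = g x + c"
    using is_hat_function_hat unfolding is_hat_function_def by blast
  obtain a where "\<And>x. g x = a \<bullet> x" using linear_functional_inner[OF g(1)] by blast
  with g(2) show ?thesis by auto
qed

end

text \<open>
  Among the slopes that describe the hat function on \<^term>\<open>T\<close> there is nothing to choose: a mesh
  triangle has interior points, which determine the slope.
\<close>

definition elem_grad :: "(real^2) set \<Rightarrow> real^2 \<Rightarrow> real^2" where
  "elem_grad T w = (SOME a. \<exists>c. \<forall>x\<in>T. hat w x = a \<bullet> x + c)"

lemma elem_grad:
  assumes "w \<in> mesh_vertices \<T>" "T \<in> \<T>"
  obtains c where "\<And>x. x \<in> T \<Longrightarrow> hat w x = elem_grad T w \<bullet> x + c"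
  using someI_ex[OF hat_affine[OF assms]] that unfolding elem_grad_def[symmetric] by blast

lemma grad_hat:
  assumes "w \<in> mesh_vertices \<T>" "T \<in> \<T>" "x \<in> interior T"
  shows "grad (hat w) x = elem_grad T w"
proof -
  obtain c where c: "\<And>x. x \<in> T \<Longrightarrow> hat w x = elem_grad T w \<bullet> x + c"
    using elem_grad[OF assms(1,2)] by blast
  have "((\<lambda>x. elem_grad T w \<bullet> x + c) has_derivative (\<lambda>h. h \<bullet> elem_grad T w)) (at x)"
    by (auto intro!: derivative_eq_intros simp: inner_commute)
  then have "(hat w has_derivative (\<lambda>h. h \<bullet> elem_grad T w)) (at x)"
    by (rule has_derivative_transform_within_open[OF _ open_interior assms(3)])
      (use c interior_subset in fastforce)
  then have der: "GDERIV (hat w) x :> elem_grad T w"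
    by (simp add: gderiv_def)
  moreover have "D = elem_grad T w" if "GDERIV (hat w) x :> D" for D
  proof -
    have "(\<lambda>h. h \<bullet> D) = (\<lambda>h. h \<bullet> elem_grad T w)"
      using that der unfolding gderiv_def by (rule has_derivative_unique)
    then show ?thesis by (metis vector_eq_ldot)
  qed
  ultimately show ?thesis unfolding grad_def by blast
qed

section \<open>The stiffness matrix and the Dirichlet energy\<close>

text \<open>
  Distinct triangles meet in proper faces, and edges are null sets; so only interiors count.
\<close>

lemma has_integral_region:
  fixes f :: "real^2 \<Rightarrow> real"
  assumes "\<And>T x. T \<in> \<T> \<Longrightarrow> x \<in> interior T \<Longrightarrow> f x = k T"
  shows "(f has_integral (\<Sum>T\<in>\<T>. measure lebesgue T * k T)) (\<Union>\<T>)"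
proof (rule has_integral_Union)
  fix T assume T: "T \<in> \<T>"
  have "T \<in> lmeasurable" using T by (simp add: compact_triangle lmeasurable_compact)
  then have "((\<lambda>x. 1) has_integral measure lebesgue T) T"
    using integrable_integral[OF integrable_on_const] lmeasure_integral by metis
  then have "((\<lambda>x. k T) has_integral (measure lebesgue T * k T)) T"
    using has_integral_mult_left[of "\<lambda>x. 1" "measure lebesgue T" T "k T"] by simp
  then show "(f has_integral (measure lebesgue T * k T)) T"
    by (rule has_integral_spike[OF negligible_convex_frontier[OF convex_triangle[OF T]], rotated])
      (use assms T closed_triangle in \<open>auto simp: frontier_def\<close>)
qed (auto simp: pairwise_def negligible_triangle_Int)

text \<open>
  The entry of the stiffness matrix for two vertices, written as the finite sum to which the integral
  reduces because all gradients are constant on each triangle.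
\<close>

definition stiffness :: "real^2 \<Rightarrow> real^2 \<Rightarrow> real" where
  "stiffness u w = (\<Sum>T\<in>\<T>. measure lebesgue T * (elem_grad T u \<bullet> elem_grad T w))"

text \<open>
  The integral runs over the open domain, the sum over the closed triangles; the two regions differ
  only by part of the frontier of the domain. This part may be more than the outer boundary: a domain
  may have slits that run through the mesh and even across triangles.
\<close>

lemma integral_grad_hat_eq_stiffness:
  assumes "u \<in> mesh_vertices \<T>" "w \<in> mesh_vertices \<T>"
    and "closure \<Omega> = \<Union>\<T>" "negligible (frontier \<Omega>)"
  shows "integral \<Omega> (\<lambda>x. grad (hat u) x \<bullet> grad (hat w) x) = stiffness u w"
proof -
  have region: "((\<lambda>x. grad (hat u) x \<bullet> grad (hat w) x) has_integral stiffness u w) (\<Union>\<T>)"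
    unfolding stiffness_def by (rule has_integral_region) (simp add: grad_hat assms)
  have "\<Union>\<T> - \<Omega> \<subseteq> frontier \<Omega>"
    using assms(3) interior_subset[of \<Omega>] by (auto simp: frontier_def)
  then have null: "negligible {x \<in> \<Union>\<T> - \<Omega>. grad (hat u) x \<bullet> grad (hat w) x \<noteq> 0}"
    by (intro negligible_subset[OF assms(4)]) blast
  have "{x \<in> \<Omega> - \<Union>\<T>. grad (hat u) x \<bullet> grad (hat w) x \<noteq> 0} = {}"
    using assms(3) closure_subset[of \<Omega>] by blast
  then have null': "negligible {x \<in> \<Omega> - \<Union>\<T>. grad (hat u) x \<bullet> grad (hat w) x \<noteq> 0}"
    by (simp only: negligible_empty)
  show ?thesis
    using has_integral_spike_set_eq[OF null null'] region by (intro integral_unique) (rule iffD1)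
qed

lemma affine_comb_elem_grad:
  assumes "T \<in> \<T>" "S \<subseteq> mesh_vertices \<T>"
  obtains c where "\<And>x. x \<in> T \<Longrightarrow> (\<Sum>w\<in>S. \<beta> w * hat w x) = (\<Sum>w\<in>S. \<beta> w *\<^sub>R elem_grad T w) \<bullet> x + c"
proof -
  have "\<forall>w\<in>S. \<exists>c. \<forall>x\<in>T. hat w x = elem_grad T w \<bullet> x + c"
  proof
    fix w assume "w \<in> S"
    then have "w \<in> mesh_vertices \<T>" using assms(2) by blast
    then obtain c where "\<And>x. x \<in> T \<Longrightarrow> hat w x = elem_grad T w \<bullet> x + c"
      using elem_grad[OF _ assms(1)] by blast
    then show "\<exists>c. \<forall>x\<in>T. hat w x = elem_grad T w \<bullet> x + c" by blast
  qed
  from bchoice[OF this]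
  obtain c where c: "\<And>w x. w \<in> S \<Longrightarrow> x \<in> T \<Longrightarrow> hat w x = elem_grad T w \<bullet> x + c w"
    by blast
  have "(\<Sum>w\<in>S. \<beta> w * hat w x) = (\<Sum>w\<in>S. \<beta> w *\<^sub>R elem_grad T w) \<bullet> x + (\<Sum>w\<in>S. \<beta> w * c w)"
    if "x \<in> T" for x
    using that by (simp add: c inner_sum_left sum.distrib[symmetric] distrib_left)
  then show ?thesis using that by blast
qed

text \<open>
  Both sides are affine on a triangle and have the same values at its corners.
\<close>

lemma affine_reproduction:
  assumes "x \<in> \<Union>\<T>"
  shows "(\<Sum>w\<in>mesh_vertices \<T>. (a \<bullet> w + c) * hat w x) = a \<bullet> x + c"
proof -
  obtain T where T: "T \<in> \<T>" "x \<in> T" using assms by auto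
  obtain c' where c': "\<And>x. x \<in> T \<Longrightarrow> (\<Sum>w\<in>mesh_vertices \<T>. (a \<bullet> w + c) * hat w x) =
      (\<Sum>w\<in>mesh_vertices \<T>. (a \<bullet> w + c) *\<^sub>R elem_grad T w) \<bullet> x + c'"
    using affine_comb_elem_grad[OF T(1) order_refl, of "\<lambda>w. a \<bullet> w + c"] by blast
  have "(\<Sum>w\<in>mesh_vertices \<T>. (a \<bullet> w + c) *\<^sub>R elem_grad T w) \<bullet> x + c' = a \<bullet> x + c"
  proof (rule affine_eq_on_convex_hull)
    show "x \<in> convex hull {w. w extreme_point_of T}" using T triangle_hull by auto
    fix v assume "v \<in> {w. w extreme_point_of T}"
    then have v: "v \<in> mesh_vertices \<T>" "v \<in> T"
      using T corner_is_vertex by (auto simp: extreme_point_of_def)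
    then show "(\<Sum>w\<in>mesh_vertices \<T>. (a \<bullet> w + c) *\<^sub>R elem_grad T w) \<bullet> v + c' = a \<bullet> v + c"
      by (simp add: c'[symmetric] hat_vertex if_distrib if_distribR of_bool_def cong: if_cong)
  qed
  then show ?thesis by (simp add: c' T)
qed

lemma elem_grad_reproduction:
  assumes "T \<in> \<T>"
  shows "(\<Sum>w\<in>mesh_vertices \<T>. (a \<bullet> w + c) *\<^sub>R elem_grad T w) = a"
proof -
  obtain c' where "\<And>x. x \<in> T \<Longrightarrow> (\<Sum>w\<in>mesh_vertices \<T>. (a \<bullet> w + c) * hat w x) =
      (\<Sum>w\<in>mesh_vertices \<T>. (a \<bullet> w + c) *\<^sub>R elem_grad T w) \<bullet> x + c'"
    using affine_comb_elem_grad[OF assms order_refl, of "\<lambda>w. a \<bullet> w + c"] by blast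
  then have "(\<Sum>w\<in>mesh_vertices \<T>. (a \<bullet> w + c) *\<^sub>R elem_grad T w) \<bullet> x + c' = a \<bullet> x + c" if "x \<in> T" for x
    using affine_reproduction[of x a c] that assms by auto
  then show ?thesis by (rule affine_gradient_unique[OF interior_triangle[OF assms]])
qed

text \<open>
  The quadratic form of the stiffness matrix is the Dirichlet energy of
  \<open>f = (\<Sum>w\<in>S. \<beta> w * hat w)\<close>. If \<^term>\<open>\<beta>\<close> is in the kernel, the energy is zero, so \<open>f\<close>
  is constant on each triangle. A continuous function with finitely many values on a connected
  region is constant, and \<open>f\<close> vanishes at a vertex outside \<^term>\<open>S\<close>; so it vanishes at
  the vertices in \<^term>\<open>S\<close>, where its values are the coefficients.
\<close>

lemma stiffness_definite:
  assumes conn: "connected (\<Union>\<T>)" and S: "S \<subset> mesh_vertices \<T>"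
    and ker: "\<And>u. u \<in> S \<Longrightarrow> (\<Sum>w\<in>S. stiffness u w * \<beta> w) = 0"
    and v: "v \<in> S"
  shows "\<beta> v = 0"
proof -
  define f where "f x = (\<Sum>w\<in>S. \<beta> w * hat w x)" for x
  define G where "G T = (\<Sum>w\<in>S. \<beta> w *\<^sub>R elem_grad T w)" for T
  have fin: "finite S" using S finite_subset[OF _ finite_vertices] by blast
  have "0 = (\<Sum>u\<in>S. \<beta> u * (\<Sum>w\<in>S. stiffness u w * \<beta> w))"
    by (simp add: ker)
  also have "\<dots> = (\<Sum>u\<in>S. \<Sum>w\<in>S. \<Sum>T\<in>\<T>. measure lebesgue T * (\<beta> u * \<beta> w * (elem_grad T u \<bullet> elem_grad T w)))"
    by (simp add: stiffness_def sum_distrib_left sum_distrib_right mult_ac)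
  also have "\<dots> = (\<Sum>T\<in>\<T>. \<Sum>u\<in>S. \<Sum>w\<in>S. measure lebesgue T * (\<beta> u * \<beta> w * (elem_grad T u \<bullet> elem_grad T w)))"
    by (rule trans[OF sum.cong[OF refl sum.swap] sum.swap])
  also have "\<dots> = (\<Sum>T\<in>\<T>. measure lebesgue T * (G T \<bullet> G T))"
    unfolding G_def inner_sum_left by (simp add: inner_sum_right sum_distrib_left mult_ac)
  finally have "\<forall>T\<in>\<T>. measure lebesgue T * (G T \<bullet> G T) = 0"
    by (subst (asm) eq_commute, subst (asm) sum_nonneg_eq_0_iff) auto
  then have G0: "G T = 0" if "T \<in> \<T>" for T
    using that measure_triangle_pos[OF that] by auto
  have "\<forall>T\<in>\<T>. \<exists>c. \<forall>x\<in>T. f x = c"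
  proof
    fix T assume T: "T \<in> \<T>"
    obtain c where "\<And>x. x \<in> T \<Longrightarrow> f x = G T \<bullet> x + c"
      using affine_comb_elem_grad[OF T, of S \<beta>] S unfolding f_def G_def by blast
    then show "\<exists>c. \<forall>x\<in>T. f x = c" by (auto simp: G0[OF T])
  qed
  from bchoice[OF this] obtain c where c: "\<And>T x. T \<in> \<T> \<Longrightarrow> x \<in> T \<Longrightarrow> f x = c T"
    by blast
  have "f ` \<Union>\<T> \<subseteq> c ` \<T>" using c by fastforce
  then have "finite (f ` \<Union>\<T>)" using finite_surj finite_triangles by blast
  moreover have "continuous_on (\<Union>\<T>) f"
    unfolding f_def by (intro continuous_intros continuous_on_hat) (use S in auto)
  ultimately have "f constant_on \<Union>\<T>"
    using continuous_finite_range_constant[OF conn] by blast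
  then obtain k where k: "\<And>x. x \<in> \<Union>\<T> \<Longrightarrow> f x = k" by (auto simp: constant_on_def)
  have f: "f u = (if u \<in> S then \<beta> u else 0)" if "u \<in> mesh_vertices \<T>" for u
  proof -
    have "f u = (\<Sum>w\<in>S. if u = w then \<beta> w else 0)"
      unfolding f_def using S that by (intro sum.cong) (auto simp: hat_vertex)
    then show ?thesis using fin by simp
  qed
  obtain b where b: "b \<in> mesh_vertices \<T>" "b \<notin> S" using S by auto
  have "\<beta> v = f v" using f S v by auto
  also have "\<dots> = f b" using k b v S vertex_subset_region by (metis psubsetD subsetD)
  finally show ?thesis using f[OF b(1)] b by simp
qed

end

section \<open>Discrete harmonicity of affine functions\<close>

context triangulated_region
begin

lemma hat_eq_0_if_not_corner:
  assumes "w \<in> mesh_vertices \<T>" "T \<in> \<T>" "x \<in> convex hull ({v. v extreme_point_of T} - {w})"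
  shows "hat w x = 0"
proof -
  obtain c where c: "\<And>x. x \<in> T \<Longrightarrow> hat w x = elem_grad T w \<bullet> x + c"
    using elem_grad[OF assms(1,2)] by blast
  have "elem_grad T w \<bullet> x + c = 0 \<bullet> x + 0"
  proof (rule affine_eq_on_convex_hull[OF _ assms(3)])
    fix v assume v: "v \<in> {v. v extreme_point_of T} - {w}"
    then have "v \<in> T" "v \<in> mesh_vertices \<T>"
      using corner_is_vertex[OF assms(2)] by (auto simp: extreme_point_of_def)
    then show "elem_grad T w \<bullet> v + c = 0 \<bullet> v + 0"
      using c hat_vertex[OF assms(1), of v] v by simp
  qed
  moreover have "x \<in> T"
    using assms(3) hull_mono[of "{v. v extreme_point_of T} - {w}" "{v. v extreme_point_of T}" convex]
      triangle_hull[OF assms(2)] by auto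
  ultimately show ?thesis using c by simp
qed

lemma hat_eq_0_off_star:
  assumes "w \<in> mesh_vertices \<T>" "T \<in> \<T>" "x \<in> T" "w \<notin> T"
  shows "hat w x = 0"
proof (rule hat_eq_0_if_not_corner[OF assms(1,2)])
  have "w \<notin> {v. v extreme_point_of T}" using assms(4) by (auto simp: extreme_point_of_def)
  then show "x \<in> convex hull ({v. v extreme_point_of T} - {w})"
    using assms triangle_hull by auto
qed

lemma hat_affine_comb:
  assumes "w \<in> mesh_vertices \<T>" "T \<in> \<T>" "x \<in> T" "y \<in> T" "0 \<le> s" "s \<le> 1"
  shows "hat w (s *\<^sub>R x + (1 - s) *\<^sub>R y) = s * hat w x + (1 - s) * hat w y"
proof -
  obtain c where c: "\<And>x. x \<in> T \<Longrightarrow> hat w x = elem_grad T w \<bullet> x + c"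
    using elem_grad[OF assms(1,2)] by blast
  have "s *\<^sub>R x + (1 - s) *\<^sub>R y \<in> T"
    using convexD[OF convex_triangle[OF assms(2)]] assms by simp
  then show ?thesis using c assms by (simp add: inner_add_right algebra_simps)
qed

text \<open>
  The value \<^term>\<open>hat w x\<close> is the barycentric coordinate of \<^term>\<open>x\<close> with respect to the corner
  \<^term>\<open>w\<close>, and \<^term>\<open>y\<close> is the projection of \<^term>\<open>x\<close> from \<^term>\<open>w\<close> to the opposite edge.
\<close>

lemma star_decomposition:
  assumes w: "w \<in> mesh_vertices \<T>" and T: "T \<in> \<T>" "w \<in> T" "x \<in> T"
  obtains y where "y \<in> T" "x = hat w x *\<^sub>R w + (1 - hat w x) *\<^sub>R y" "0 \<le> hat w x" "hat w x \<le> 1"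
proof -
  define C where "C = {v. v extreme_point_of T} - {w}"
  have "insert w C = {v. v extreme_point_of T}"
    using vertex_is_corner[OF w T(1,2)] by (auto simp: C_def)
  then have hull: "T = convex hull (insert w C)" using triangle_hull[OF T(1)] by simp
  show ?thesis
  proof (cases "C = {}")
    case True
    have "x = w" using T(3) hull[unfolded True] by simp
    then show ?thesis using that[of w] T hat_vertex[OF w w] by simp
  next
    case False
    have "x \<in> convex hull (insert w C)" using T(3) hull by simp
    then obtain s t y where st: "s \<ge> 0" "t \<ge> 0" "s + t = 1" "y \<in> convex hull C" "x = s *\<^sub>R w + t *\<^sub>R y"
      unfolding convex_hull_insert[OF False] by blast
    then have "t = 1 - s" by simp
    with st have s: "s \<ge> 0" "s \<le> 1" "y \<in> convex hull C" "x = s *\<^sub>R w + (1 - s) *\<^sub>R y"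
      by simp_all
    have "y \<in> T" using s(3) hull hull_mono[of C "insert w C" convex] by auto
    moreover have "hat w x = s"
      using hat_affine_comb[OF w T(1,2) \<open>y \<in> T\<close>] s hat_eq_0_if_not_corner[OF w T(1) s(3)[unfolded C_def]]
      by (simp add: hat_vertex[OF w w])
    ultimately show ?thesis using that[of y] s by simp
  qed
qed

lemma hat_nonneg:
  assumes "w \<in> mesh_vertices \<T>" "x \<in> \<Union>\<T>"
  shows "0 \<le> hat w x"
proof -
  obtain T where T: "T \<in> \<T>" "x \<in> T" using assms by auto
  show ?thesis
  proof (cases "w \<in> T")
    case True
    then show ?thesis using star_decomposition[OF assms(1) T(1) _ T(2)] by blast
  qed (use hat_eq_0_off_star[OF assms(1) T] in simp)
qed

text \<open>
  The open star of an interior vertex \<^term>\<open>w\<close> contains no boundary points of the region. Shrink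
  \<^term>\<open>x\<close> towards \<^term>\<open>w\<close> by a factor \<open>\<epsilon>\<close> to a point \<open>m\<close> so close to \<^term>\<open>w\<close> that all points near
  \<open>m\<close> lie in triangles with corner \<^term>\<open>w\<close>. Since \<^term>\<open>hat w x\<close> is positive, \<^term>\<open>hat w\<close> exceeds
  \<open>1 - \<epsilon>\<close> at \<open>m\<close> and therefore near \<open>m\<close>. In a triangle with corner \<^term>\<open>w\<close>, a point with that
  barycentric coordinate can be moved away from \<^term>\<open>w\<close> by the factor \<open>1 / \<epsilon>\<close> without leaving the
  triangle. So a neighbourhood of \<open>m\<close>, blown up from \<^term>\<open>w\<close>, is a neighbourhood of \<^term>\<open>x\<close> that the
  triangles cover.
\<close>

lemma hat_pos_imp_interior:
  assumes w: "w \<in> mesh_vertices \<T>" "w \<in> interior (\<Union>\<T>)"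
    and x: "x \<in> \<Union>\<T>" "hat w x > 0"
  shows "x \<in> interior (\<Union>\<T>)"
proof -
  obtain T where T: "T \<in> \<T>" "x \<in> T" using x by auto
  have wT: "w \<in> T" using hat_eq_0_off_star[OF w(1) T] x(2) by auto
  let ?K = "\<Union>{T \<in> \<T>. w \<notin> T}"
  have "closed ?K" by (intro closed_Union) (auto simp: closed_triangle)
  then have "open (interior (\<Union>\<T>) - ?K)" by (intro open_Diff) auto
  moreover have "w \<in> interior (\<Union>\<T>) - ?K" using w by auto
  ultimately obtain r where r: "r > 0" "ball w r \<subseteq> interior (\<Union>\<T>) - ?K"
    using open_contains_ball by blast
  (* shift by 1 so that the bound N stays positive when x = w *)
  define N where "N = norm (x - w) + 1"
  have N: "N > 0" "norm (x - w) \<le> N" unfolding N_def using norm_ge_zero[of "x - w"] by linarith+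
  define \<epsilon> where "\<epsilon> = min 1 (r / (2 * N))"
  have \<epsilon>: "0 < \<epsilon>" "\<epsilon> \<le> 1" using r(1) N(1) by (auto simp: \<epsilon>_def)
  have "\<epsilon> * norm (x - w) \<le> r / (2 * N) * N"
    using N r(1) by (intro mult_mono) (auto simp: \<epsilon>_def)
  also have "\<dots> < r" using N(1) r(1) by simp
  finally have \<epsilon>r: "\<epsilon> * norm (x - w) < r" .
  define m where "m = (1 - \<epsilon>) *\<^sub>R w + (1 - (1 - \<epsilon>)) *\<^sub>R x"
  have m_eq: "m = w + \<epsilon> *\<^sub>R (x - w)" by (simp add: m_def algebra_simps)
  have "hat w m = (1 - \<epsilon>) * hat w w + (1 - (1 - \<epsilon>)) * hat w x"
    unfolding m_def by (rule hat_affine_comb[OF w(1) T(1) wT T(2)]) (use \<epsilon> in auto)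
  then have "hat w m > 1 - \<epsilon>" using \<epsilon> x(2) by (simp add: hat_vertex[OF w(1) w(1)])
  moreover have "m \<in> ball w r" using \<epsilon>r \<epsilon>(1) by (simp add: m_eq dist_norm)
  moreover have "open {z \<in> ball w r. hat w z > 1 - \<epsilon>}"
  proof -
    have "continuous_on (ball w r) (hat w)"
      using continuous_on_hat[OF w(1)] r(2) interior_subset by (blast intro: continuous_on_subset)
    then have "open (hat w -` {1 - \<epsilon><..} \<inter> ball w r)"
      by (simp add: continuous_on_open_vimage)
    moreover have "hat w -` {1 - \<epsilon><..} \<inter> ball w r = {z \<in> ball w r. hat w z > 1 - \<epsilon>}" by auto
    ultimately show ?thesis by simp
  qed
  ultimately obtain \<delta> where \<delta>: "\<delta> > 0" "ball m \<delta> \<subseteq> {z \<in> ball w r. hat w z > 1 - \<epsilon>}"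
    unfolding open_contains_ball by blast
  have "ball x (\<delta> / \<epsilon>) \<subseteq> \<Union>\<T>"
  proof
    fix z assume z: "z \<in> ball x (\<delta> / \<epsilon>)"
    define z' where "z' = w + \<epsilon> *\<^sub>R (z - w)"
    have "m - z' = \<epsilon> *\<^sub>R (x - z)" by (simp add: m_eq z'_def algebra_simps)
    then have "dist m z' = \<epsilon> * dist x z" using \<epsilon>(1) by (simp add: dist_norm)
    then have "z' \<in> ball m \<delta>" using z \<epsilon>(1) by (simp add: field_simps)
    then have z': "z' \<in> ball w r" "hat w z' > 1 - \<epsilon>" using \<delta>(2) by auto
    then obtain T' where T': "T' \<in> \<T>" "z' \<in> T'" "w \<in> T'"
      using r(2) interior_subset by blast
    obtain y where y: "y \<in> T'" "z' = hat w z' *\<^sub>R w + (1 - hat w z') *\<^sub>R y" "hat w z' \<le> 1"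
      using star_decomposition[OF w(1) T'(1,3,2)] by blast
    (* s is the coordinate of z opposite to w; it is at most 1 as hat w z' exceeds 1 - \<epsilon> *)
    define s where "s = (1 - hat w z') / \<epsilon>"
    have s: "0 \<le> s" "s \<le> 1" using z'(2) y(3) \<epsilon>(1) by (auto simp: s_def field_simps)
    have "\<epsilon> *\<^sub>R (z - w) = z' - w" by (simp add: z'_def)
    also have "\<dots> = (1 - hat w z') *\<^sub>R (y - w)" by (subst y(2)) (simp add: algebra_simps)
    also have "\<dots> = \<epsilon> *\<^sub>R (s *\<^sub>R (y - w))" using \<epsilon>(1) by (simp add: s_def)
    finally have "z - w = s *\<^sub>R (y - w)" using \<epsilon>(1) by (simp only: scaleR_cancel_left) simp
    then have "z = (1 - s) *\<^sub>R w + s *\<^sub>R y" by (simp add: algebra_simps)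
    then have "z \<in> T'"
      using convexD[OF convex_triangle[OF T'(1)] T'(3) y(1), of "1 - s" s] s by simp
    then show "z \<in> \<Union>\<T>" using T' by auto
  qed
  moreover have "\<delta> / \<epsilon> > 0" using \<delta> \<epsilon> by simp
  ultimately show ?thesis by (meson mem_interior)
qed

text \<open>
  The weighted sum is the integral of the gradient of the hat function over the region. Extended by
  zero to the plane, the hat function of an interior vertex stays Lipschitz, as the set where it is
  positive is open, and has bounded support; so the integral of each directional derivative is zero.
\<close>

lemma sum_elem_grad_interior_vertex:
  assumes w: "w \<in> mesh_vertices \<T>" "w \<in> interior (\<Union>\<T>)"
  shows "(\<Sum>T\<in>\<T>. measure lebesgue T *\<^sub>R elem_grad T w) = 0"
proof -
  define P where "P = {x \<in> \<Union>\<T>. hat w x > 0}"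
  define \<Phi> where "\<Phi> x = (if x \<in> \<Union>\<T> then hat w x else 0)" for x
  have closed: "closed (\<Union>\<T>)" by (simp add: compact_imp_closed compact_region)
  have "open P"
  proof -
    have "continuous_on (interior (\<Union>\<T>)) (hat w)"
      using continuous_on_hat[OF w(1)] interior_subset by (blast intro: continuous_on_subset)
    then have "open (hat w -` {0<..} \<inter> interior (\<Union>\<T>))"
      by (simp add: continuous_on_open_vimage)
    moreover have "hat w -` {0<..} \<inter> interior (\<Union>\<T>) = P"
      using hat_pos_imp_interior[OF w] interior_subset[of "\<Union>\<T>"] by (auto simp: P_def)
    ultimately show ?thesis by simp
  qed
  have \<Phi>_0: "\<Phi> x = 0" if "x \<in> - P" for x
  proof (cases "x \<in> \<Union>\<T>")
    case True
    then have "\<not> hat w x > 0" using that unfolding P_def by blast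
    with hat_nonneg[OF w(1) True] show ?thesis by (simp add: \<Phi>_def)
  next
    case False
    then show ?thesis unfolding \<Phi>_def by (rule if_not_P)
  qed
  define M where "M = (\<Sum>T\<in>\<T>. norm (elem_grad T w))"
  have lip: "M-lipschitz_on UNIV \<Phi>"
  proof (rule lipschitz_on_closed_cover[of "insert (- P) \<T>"])
    show "M \<ge> 0" by (simp add: M_def sum_nonneg)
    show "\<Union>(insert (- P) \<T>) = UNIV" by (auto simp: P_def)
    fix S assume S: "S \<in> insert (- P) \<T>"
    show "closed S" using S \<open>open P\<close> closed_triangle by auto
    show "M-lipschitz_on S \<Phi>"
    proof (cases "S = - P")
      case True
      then show ?thesis using \<Phi>_0 \<open>M \<ge> 0\<close> by (auto simp: lipschitz_on_def)
    next
      case False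
      then have "S \<in> \<T>" using S by auto
      then obtain c where c: "\<And>x. x \<in> S \<Longrightarrow> hat w x = elem_grad S w \<bullet> x + c"
        using elem_grad[OF w(1)] by blast
      have le: "norm (elem_grad S w) \<le> M"
        unfolding M_def by (rule member_le_sum) (use \<open>S \<in> \<T>\<close> in auto)
      show ?thesis
      proof (rule lipschitz_onI)
        fix x y assume xy: "x \<in> S" "y \<in> S"
        then have "dist (\<Phi> x) (\<Phi> y) = \<bar>elem_grad S w \<bullet> (x - y)\<bar>"
          using \<open>S \<in> \<T>\<close> c by (auto simp: \<Phi>_def dist_norm inner_diff_right)
        also have "\<dots> \<le> norm (elem_grad S w) * norm (x - y)" by (rule Cauchy_Schwarz_ineq2)
        also have "\<dots> \<le> M * dist x y" using le by (simp add: dist_norm mult_right_mono)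
        finally show "dist (\<Phi> x) (\<Phi> y) \<le> M * dist x y" .
      qed fact
    qed
  qed simp
  obtain R where R: "\<And>x. x \<in> \<Union>\<T> \<Longrightarrow> norm x \<le> R"
    using compact_imp_bounded[OF compact_region] by (auto simp: bounded_iff)
  have "(\<Sum>T\<in>\<T>. measure lebesgue T *\<^sub>R elem_grad T w) \<bullet> e = 0" for e
  proof -
    (* interiors rather than closed triangles, so that at most one summand is nonzero *)
    define D where "D x = (\<Sum>T\<in>\<T>. indicat_real (interior T) x * (elem_grad T w \<bullet> e))" for x
    have disj: "interior T \<inter> interior T' = {}" if "T \<in> \<T>" "T' \<in> \<T>" "T \<noteq> T'" for T T'
      using negligible_triangle_Int[OF that] open_not_negligible[of "interior T \<inter> interior T'"]
      by (metis Int_mono interior_subset negligible_subset open_Int open_interior)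
    have "negligible (\<Union>T\<in>\<T>. frontier T)"
      by (intro negligible_Union) (auto simp: convex_triangle negligible_convex_frontier)
    moreover have "closed (\<Union>T\<in>\<T>. frontier T)"
      by (intro closed_UN) (auto simp: frontier_closed)
    ultimately have "(\<Union>T\<in>\<T>. frontier T) \<in> null_sets lborel"
      by (simp add: negligible_iff_null_sets null_sets_completion_iff)
    then have "AE x in lborel. x \<notin> (\<Union>T\<in>\<T>. frontier T)"
      by (rule AE_not_in)
    then have deriv: "AE x in lborel. ((\<lambda>t. (\<Phi> (x + t *\<^sub>R e) - \<Phi> x) / t) \<longlongrightarrow> D x) (at 0)"
    proof eventually_elim
      case (elim x)
      show ?case
      proof (cases "x \<in> \<Union>\<T>")
        case True
        then obtain T where T: "T \<in> \<T>" "x \<in> T" by auto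
        then have x: "x \<in> interior T" using elim closed_triangle[OF T(1)] by (auto simp: frontier_def)
        obtain c where "\<And>x. x \<in> T \<Longrightarrow> hat w x = elem_grad T w \<bullet> x + c"
          using elem_grad[OF w(1) T(1)] by blast
        then have "\<Phi> y = elem_grad T w \<bullet> y + c" if "y \<in> interior T" for y
          using that interior_subset[of T] T(1) by (auto simp: \<Phi>_def)
        then have "((\<lambda>t. (\<Phi> (x + t *\<^sub>R e) - \<Phi> x) / t) \<longlongrightarrow> elem_grad T w \<bullet> e) (at 0)"
          by (rule affine_directional_derivative[OF open_interior x])
        moreover have "D x = (\<Sum>T'\<in>\<T>. if T' = T then elem_grad T w \<bullet> e else 0)"
          unfolding D_def using disj T(1) x by (intro sum.cong) (auto simp: indicator_def)
        ultimately show ?thesis using T(1) by simp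
      next
        case False
        then have "D x = 0" using interior_subset by (auto simp: D_def indicator_def intro!: sum.neutral)
        moreover have "((\<lambda>t. (\<Phi> (x + t *\<^sub>R e) - \<Phi> x) / t) \<longlongrightarrow> 0 \<bullet> e) (at 0)"
          using False closed by (intro affine_directional_derivative[of "- \<Union>\<T>" _ _ _ 0]) (auto simp: \<Phi>_def)
        ultimately show ?thesis by simp
      qed
    qed
    have "integral\<^sup>L lborel D = 0"
    proof (rule integral_directional_derivative_eq_0[OF lip _ _ deriv])
      show "\<Phi> x = 0" if "norm x > R" for x using R[of x] that by (auto simp: \<Phi>_def)
      show "D \<in> borel_measurable borel" unfolding D_def by measurable
    qed
    moreover have "measure lborel (interior T) = measure lebesgue T" 
      "emeasure lborel (interior T) < \<infinity>" if "T \<in> \<T>" for T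
    proof -
      have bdd: "bounded (interior T)"
        using compact_triangle[OF that] compact_imp_bounded bounded_interior by blast
      show "measure lborel (interior T) = measure lebesgue T"
        using measure_interior[OF compact_imp_bounded[OF compact_triangle[OF that]]
            negligible_convex_frontier[OF convex_triangle[OF that]]] by simp
      show "emeasure lborel (interior T) < \<infinity>" using bdd by (rule emeasure_bounded_finite)
    qed
    then have "integral\<^sup>L lborel D = (\<Sum>T\<in>\<T>. measure lebesgue T * (elem_grad T w \<bullet> e))"
      unfolding D_def by (subst Bochner_Integration.integral_sum) auto
    ultimately show ?thesis by (simp add: inner_sum_left)
  qed
  then show ?thesis by (metis inner_eq_zero_iff)
qed

text \<open>
  Affine functions are discretely harmonic at interior vertices: the hat functions reproduce
  \<open>a \<bullet> x + c\<close>, whose gradient is the constant \<^term>\<open>a\<close>, so the sum is the inner product of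
  \<^term>\<open>a\<close> with the integral of the gradient of the hat function of \<^term>\<open>w\<close>.
\<close>

lemma stiffness_affine:
  assumes w: "w \<in> mesh_vertices \<T>" "w \<in> interior (\<Union>\<T>)"
  shows "(\<Sum>u\<in>mesh_vertices \<T>. stiffness w u * (a \<bullet> u + c)) = 0"
proof -
  have "(\<Sum>u\<in>mesh_vertices \<T>. stiffness w u * (a \<bullet> u + c)) =
      (\<Sum>u\<in>mesh_vertices \<T>. \<Sum>T\<in>\<T>. measure lebesgue T * (elem_grad T w \<bullet> ((a \<bullet> u + c) *\<^sub>R elem_grad T u)))"
    by (simp add: stiffness_def sum_distrib_left sum_distrib_right mult_ac)
  also have "\<dots> = (\<Sum>T\<in>\<T>. \<Sum>u\<in>mesh_vertices \<T>. measure lebesgue T * (elem_grad T w \<bullet> ((a \<bullet> u + c) *\<^sub>R elem_grad T u)))"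
    by (rule sum.swap)
  also have "\<dots> = (\<Sum>T\<in>\<T>. measure lebesgue T * (elem_grad T w \<bullet> (\<Sum>u\<in>mesh_vertices \<T>. (a \<bullet> u + c) *\<^sub>R elem_grad T u)))"
    by (simp only: inner_sum_right sum_distrib_left)
  also have "\<dots> = (\<Sum>T\<in>\<T>. measure lebesgue T *\<^sub>R elem_grad T w) \<bullet> a"
    by (simp add: elem_grad_reproduction inner_sum_left)
  also have "\<dots> = 0" by (simp add: sum_elem_grad_interior_vertex[OF w])
  finally show ?thesis .
qed

text \<open>
  A vertex with the largest first coordinate: all triangles lie in the half plane to its left.
\<close>

lemma ex_boundary_vertex:
  assumes "\<T> \<noteq> {}"
  obtains b where "b \<in> mesh_vertices \<T>" "b \<notin> interior (\<Union>\<T>)"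
proof -
  obtain T where "T \<in> \<T>" using assms by auto
  then have "{w. w extreme_point_of T} \<noteq> {}"
    using triangle_hull[of T] interior_triangle[of T] by auto
  then have "mesh_vertices \<T> \<noteq> {}" using corner_is_vertex[OF \<open>T \<in> \<T>\<close>] by auto
  then have "Max ((\<lambda>v. v $ 1) ` mesh_vertices \<T>) \<in> (\<lambda>v. v $ 1) ` mesh_vertices \<T>"
    by (intro Max_in) auto
  then obtain b where b: "b \<in> mesh_vertices \<T>" "b $ 1 = Max ((\<lambda>v. v $ 1) ` mesh_vertices \<T>)"
    by auto
  then have b_max: "v $ 1 \<le> b $ 1" if "v \<in> mesh_vertices \<T>" for v using that by simp
  have le: "x $ 1 \<le> b $ 1" if x: "x \<in> \<Union>\<T>" for x
  proof -
    obtain T where T: "T \<in> \<T>" "x \<in> T" using x by auto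
    have "convex {x :: real^2. axis 1 1 \<bullet> x \<le> b $ 1}" by (rule convex_halfspace_le)
    then have "convex hull {w. w extreme_point_of T} \<subseteq> {x. x $ 1 \<le> b $ 1}"
      using b_max corner_is_vertex[OF T(1)] by (intro hull_minimal) (auto simp: inner_axis')
    then show ?thesis using T triangle_hull by blast
  qed
  have "b \<notin> interior (\<Union>\<T>)"
  proof
    assume "b \<in> interior (\<Union>\<T>)"
    then obtain r where r: "r > 0" "cball b r \<subseteq> \<Union>\<T>" by (meson mem_interior_cball)
    have "b + r *\<^sub>R axis 1 1 \<in> cball b r" using r by (simp add: dist_norm)
    then show False using le[of "b + r *\<^sub>R axis 1 1"] r by (simp add: subset_iff)
  qed
  then show ?thesis using b that by blast
qed

end

section \<open>Submatrices and the linear system\<close>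

lemma bij_betw_pick:
  assumes "finite J"
  shows "bij_betw (pick J) {..<card J} J"
proof -
  have "inj_on (pick J) {..<card J}"
    by (rule inj_onI) (metis card_pick_le lessThan_iff)
  moreover have "pick J ` {..<card J} \<subseteq> J" using pick_in_set_le by auto
  ultimately show ?thesis
    using assms by (metis bij_betw_imageI card_image card_lessThan card_subset_eq)
qed

lemma sum_pick: "finite J \<Longrightarrow> (\<Sum>b<card J. g (pick J b)) = sum g J"
  using sum.reindex_bij_betw[OF bij_betw_pick] .

lemma submatrix_mat:
  assumes "I \<subseteq> {..<m}" "J \<subseteq> {..<n}"
  shows "submatrix (Matrix.mat m n f) I J =
    Matrix.mat (card I) (card J) (\<lambda>(a, b). f (pick I a, pick J b))"
proof -
  have "{i. i < m \<and> i \<in> I} = I" "{j. j < n \<and> j \<in> J} = J" using assms by auto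
  then show ?thesis
    using pick_in_set_le assms by (auto simp: submatrix_def intro!: eq_matI) (auto simp: subset_eq)
qed

lemma submatrix_mat_UNIV:
  assumes "I \<subseteq> {..<m}"
  shows "submatrix (Matrix.mat m n f) I UNIV = Matrix.mat (card I) n (\<lambda>(a, b). f (pick I a, b))"
proof -
  have "{i. i < m \<and> i \<in> I} = I" using assms by auto
  then show ?thesis
    using pick_in_set_le assms by (auto simp: submatrix_def pick_UNIV intro!: eq_matI) (auto simp: subset_eq)
qed

lemma invertible_mat_if_kernel_trivial:
  fixes A :: "'a::field Matrix.mat"
  assumes A: "A \<in> carrier_mat m m"
    and ker: "\<And>v. v \<in> carrier_vec m \<Longrightarrow> A *\<^sub>v v = 0\<^sub>v m \<Longrightarrow> v = 0\<^sub>v m"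
  shows "invertible_mat A"
proof -
  have "Determinant.det A \<noteq> 0" using det_0_iff_vec_prod_zero_field[OF A] ker by blast
  from det_non_zero_imp_unit[OF A this, of undefined] obtain B where
    B: "B \<in> carrier_mat m m" "B * A = 1\<^sub>m m" "A * B = 1\<^sub>m m"
    by (auto simp: Units_def ring_mat_simps)
  then show ?thesis using A by (auto simp: invertible_mat_def inverts_mat_def)
qed

lemma A_I_eq_mat:
  "A_I \<Omega> \<T> n p =
    Matrix.mat (card (interior_indices \<Omega> n p)) (card (interior_indices \<Omega> n p))
      (\<lambda>(a, b). stiffness_matrix \<Omega> \<T> n p $$
        (pick (interior_indices \<Omega> n p) a, pick (interior_indices \<Omega> n p) b))"
  and A_B_eq_mat:
  "A_B \<Omega> \<T> n p =
    Matrix.mat (card (interior_indices \<Omega> n p)) (card (boundary_indices \<Omega> n p))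
      (\<lambda>(a, b). stiffness_matrix \<Omega> \<T> n p $$
        (pick (interior_indices \<Omega> n p) a, pick (boundary_indices \<Omega> n p) b))"
proof -
  let ?A = "stiffness_matrix \<Omega> \<T> n p"
  have sub: "interior_indices \<Omega> n p \<subseteq> {..<n}" "boundary_indices \<Omega> n p \<subseteq> {..<n}"
    by (auto simp: interior_indices_def boundary_indices_def)
  have A: "?A = Matrix.mat n n (\<lambda>(i, j). ?A $$ (i, j))"
    by (auto simp: stiffness_matrix_def)
  show "A_I \<Omega> \<T> n p =
    Matrix.mat (card (interior_indices \<Omega> n p)) (card (interior_indices \<Omega> n p))
      (\<lambda>(a, b). ?A $$ (pick (interior_indices \<Omega> n p) a, pick (interior_indices \<Omega> n p) b))"
    unfolding A_I_def by (subst A, subst submatrix_mat[OF sub(1) sub(1)]) simp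
  show "A_B \<Omega> \<T> n p =
    Matrix.mat (card (interior_indices \<Omega> n p)) (card (boundary_indices \<Omega> n p))
      (\<lambda>(a, b). ?A $$ (pick (interior_indices \<Omega> n p) a, pick (boundary_indices \<Omega> n p) b))"
    unfolding A_B_def by (subst A, subst submatrix_mat[OF sub(1) sub(2)]) simp
qed

text \<open>
  The linear system as equations between sums over vertex indices, for either coordinate; the
  numbering of rows and columns of submatrices does not appear any more.
\<close>

lemma femwarp_solution_rows:
  assumes "femwarp_solution \<Omega> \<T> n p q" "i \<in> interior_indices \<Omega> n p"
  shows "(\<Sum>j\<in>interior_indices \<Omega> n p. stiffness_matrix \<Omega> \<T> n p $$ (i, j) * q j $ l) =
    - (\<Sum>j\<in>boundary_indices \<Omega> n p. stiffness_matrix \<Omega> \<T> n p $$ (i, j) * q j $ l)"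
proof -
  let ?I = "interior_indices \<Omega> n p" and ?B = "boundary_indices \<Omega> n p"
  let ?A = "stiffness_matrix \<Omega> \<T> n p"
  let ?q = "\<lambda>j k. if k = 0 then q j $ 1 else q j $ 2"
  have sub: "?I \<subseteq> {..<n}" "?B \<subseteq> {..<n}"
    by (auto simp: interior_indices_def boundary_indices_def)
  then have fin: "finite ?I" "finite ?B" by (auto intro: finite_subset)
  have X: "coordinate_matrix n q J = Matrix.mat (card J) 2 (\<lambda>(b, k). ?q (pick J b) k)"
    if "J \<subseteq> {..<n}" for J
    unfolding coordinate_matrix_def by (subst submatrix_mat_UNIV[OF that]) simp
  obtain a where a: "a < card ?I" "i = pick ?I a"
    using bij_betw_pick[OF fin(1)] assms(2) by (auto simp: bij_betw_def)
  (* the two columns are numbered from 0, the components of points from 1 *)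
  define k where "k = (if l = 1 then 0 else 1 :: nat)"
  have k: "k < 2" "?q j k = q j $ l" for j
    using exhaust_2[of l] by (auto simp: k_def)
  have "(A_I \<Omega> \<T> n p * coordinate_matrix n q ?I) $$ (a, k) =
      (- A_B \<Omega> \<T> n p * coordinate_matrix n q ?B) $$ (a, k)"
    using assms(1) by (simp add: femwarp_solution_def)
  then have "(\<Sum>b<card ?I. ?A $$ (i, pick ?I b) * ?q (pick ?I b) k) =
      - (\<Sum>b<card ?B. ?A $$ (i, pick ?B b) * ?q (pick ?B b) k)"
    using a k(1) by (simp add: A_I_eq_mat A_B_eq_mat X[OF sub(1)] X[OF sub(2)] scalar_prod_def sum_negf atLeast0LessThan)
  then show ?thesis
    unfolding k(2) using sum_pick[OF fin(1), of "\<lambda>j. ?A $$ (i, j) * q j $ l"]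
      sum_pick[OF fin(2), of "\<lambda>j. ?A $$ (i, j) * q j $ l"] by simp
qed

section \<open>Affine deformations\<close>

lemma negligible_frontier_polygonal:
  assumes "bounded_polygonal_domain \<Omega>"
  shows "negligible (frontier \<Omega>)"
proof -
  obtain E where E: "finite E" "frontier \<Omega> = (\<Union>(a, b)\<in>E. closed_segment a b)"
    using assms by (auto simp: bounded_polygonal_domain_def)
  have "negligible (closed_segment a b)" for a b :: "real^2"
    by (simp add: negligible_convex_interior interior_closed_segment_ge2)
  then show ?thesis unfolding E(2) using E(1) by (intro negligible_Union) auto
qed

theorem lemma3p1:
  fixes \<Omega> :: "(real^2) set" and \<T> :: "(real^2) set set"
    and n :: nat and p :: "nat \<Rightarrow> real^2"
  assumes "bounded_polygonal_domain \<Omega>"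
    and "triangular_mesh \<Omega> \<T>"
    and "bij_betw p {..<n} (mesh_vertices \<T>)"
  shows "invertible_mat (A_I \<Omega> \<T> n p) \<and>
    (\<forall>(q :: nat \<Rightarrow> real^2) (L :: real^2^2) (v :: real^2).
       invertible L \<longrightarrow>
       (\<forall>j\<in>boundary_indices \<Omega> n p. q j = L *v p j + v) \<longrightarrow>
       femwarp_solution \<Omega> \<T> n p q \<longrightarrow>
       (\<forall>i\<in>interior_indices \<Omega> n p. q i = L *v p i + v))"
proof -
  interpret triangulated_region \<T>
    using assms(2) by unfold_locales (auto simp: triangular_mesh_def)
  let ?I = "interior_indices \<Omega> n p" and ?B = "boundary_indices \<Omega> n p"
  let ?A = "stiffness_matrix \<Omega> \<T> n p"
  have cl: "closure \<Omega> = \<Union>\<T>" using assms(2) by (simp add: triangular_mesh_def)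
  have \<Omega>: "open \<Omega>" "connected \<Omega>" "\<Omega> \<noteq> {}"
    using assms(1) by (auto simp: bounded_polygonal_domain_def)
  have null: "negligible (frontier \<Omega>)" by (rule negligible_frontier_polygonal[OF assms(1)])
  have conn: "connected (\<Union>\<T>)" using \<Omega>(2) cl connected_imp_connected_closure by metis
  have p: "p j \<in> mesh_vertices \<T>" if "j < n" for j
    using assms(3) that by (auto simp: bij_betw_def)
  have inj: "inj_on p {..<n}" using assms(3) by (simp add: bij_betw_def)
  have A: "?A $$ (i, j) = stiffness (p i) (p j)" if "i < n" "j < n" for i j
    using that by (simp add: stiffness_matrix_def integral_grad_hat_eq_stiffness[OF p p cl null])
  have sub: "?I \<subseteq> {..<n}" by (auto simp: interior_indices_def)
  then have fin: "finite ?I" by (auto intro: finite_subset)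
  have split: "{..<n} = ?I \<union> ?B" "?I \<inter> ?B = {}" and finB: "finite ?B"
    by (auto simp: interior_indices_def boundary_indices_def)
  have interior: "p i \<in> interior (\<Union>\<T>)" if "i \<in> ?I" for i
  proof -
    have "p i \<in> closure \<Omega>" "p i \<notin> frontier \<Omega>"
      using that p[of i] vertex_subset_region cl by (auto simp: interior_indices_def)
    then have "p i \<in> interior \<Omega>" by (auto simp: frontier_def)
    moreover have "interior \<Omega> \<subseteq> interior (closure \<Omega>)" by (intro interior_mono closure_subset)
    ultimately show ?thesis unfolding cl by blast
  qed
  (* Invertibility applies this to a kernel vector, the second claim to one coordinate of the
     difference of two solutions. *)
  have kernel: "c j = 0" if c: "\<And>i. i \<in> ?I \<Longrightarrow> (\<Sum>j\<in>?I. ?A $$ (i, j) * c j) = 0" and j: "j \<in> ?I"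
    for c :: "nat \<Rightarrow> real" and j
  proof -
    have injI: "inj_on p ?I" using inj sub by (rule inj_on_subset)
    define \<beta> where "\<beta> w = c (inv_into ?I p w)" for w
    have \<beta>: "\<beta> (p j) = c j" if "j \<in> ?I" for j
      using that injI by (simp add: \<beta>_def)
    have "\<beta> (p j) = 0"
    proof (rule stiffness_definite[OF conn])
      have "\<T> \<noteq> {}" using cl \<Omega>(3) by auto
      then obtain b where b: "b \<in> mesh_vertices \<T>" "b \<notin> interior (\<Union>\<T>)"
        using ex_boundary_vertex by blast
      have "p ` ?I \<subseteq> mesh_vertices \<T>" using p sub by (auto simp: subset_eq)
      moreover have "b \<notin> p ` ?I" using b(2) interior by auto
      ultimately show "p ` ?I \<subset> mesh_vertices \<T>" using b(1) by auto
      show "(\<Sum>w\<in>p ` ?I. stiffness u w * \<beta> w) = 0" if u: "u \<in> p ` ?I" for u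
      proof -
        obtain i where i: "i \<in> ?I" "u = p i" using u by auto
        have "(\<Sum>w\<in>p ` ?I. stiffness u w * \<beta> w) = (\<Sum>j\<in>?I. stiffness u (p j) * \<beta> (p j))"
          using injI by (simp add: sum.reindex)
        also have "\<dots> = (\<Sum>j\<in>?I. ?A $$ (i, j) * c j)"
          using i sub by (intro sum.cong) (auto simp: A \<beta> subset_eq)
        finally show ?thesis using c i by simp
      qed
    qed (use j in auto)
    then show ?thesis using \<beta>[OF j] by simp
  qed
  have "invertible_mat (A_I \<Omega> \<T> n p)"
  proof (rule invertible_mat_if_kernel_trivial)
    show "A_I \<Omega> \<T> n p \<in> carrier_mat (card ?I) (card ?I)" by (simp add: A_I_eq_mat)
    fix x assume x: "x \<in> carrier_vec (card ?I)" "A_I \<Omega> \<T> n p *\<^sub>v x = 0\<^sub>v (card ?I)"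
    (* the value of x at the row where submatrices place index j, the inverse of pick *)
    define c where "c j = vec_index x (card {a \<in> ?I. a < j})" for j
    have c: "c (pick ?I b) = vec_index x b" if "b < card ?I" for b
      using that by (simp add: c_def card_pick_le)
    have "(\<Sum>j\<in>?I. ?A $$ (i, j) * c j) = 0" if i: "i \<in> ?I" for i
    proof -
      obtain a where a: "a < card ?I" "i = pick ?I a"
        using bij_betw_pick[OF fin] i by (auto simp: bij_betw_def)
      have "vec_index (A_I \<Omega> \<T> n p *\<^sub>v x) a = 0" using x(2) a by simp
      then have "(\<Sum>b<card ?I. ?A $$ (i, pick ?I b) * c (pick ?I b)) = 0"
        using a x(1) by (simp add: A_I_eq_mat scalar_prod_def c atLeast0LessThan)
      then show ?thesis using sum_pick[OF fin, of "\<lambda>j. ?A $$ (i, j) * c j"] by simp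
    qed
    from kernel[OF this] have "vec_index x b = 0" if "b < card ?I" for b
      using c[OF that] pick_in_set_le[OF that] by metis
    then show "x = 0\<^sub>v (card ?I)" using x(1) by (intro eq_vecI) auto
  qed
  moreover have "q i = L *v p i + v"
    if q: "\<forall>j\<in>?B. q j = L *v p j + v" "femwarp_solution \<Omega> \<T> n p q" and i: "i \<in> ?I"
    for q :: "nat \<Rightarrow> real^2" and L :: "real^2^2" and v i
  proof -
    (* r is another solution with the same boundary data *)
    define r where "r j = L *v p j + v" for j
    have "(q i - r i) $ l = 0" for l
    proof (rule kernel[where c = "\<lambda>j. (q j - r j) $ l"])
      fix i assume i: "i \<in> ?I"
      then have "i < n" using sub by auto
      have r: "r j $ l = L $ l \<bullet> p j + v $ l" for j
        by (simp add: r_def matrix_vector_mul_component)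
      have "(\<Sum>j\<in>?I. ?A $$ (i, j) * r j $ l) + (\<Sum>j\<in>?B. ?A $$ (i, j) * r j $ l) =
          (\<Sum>j<n. ?A $$ (i, j) * r j $ l)"
        unfolding split(1) using fin finB split(2) by (simp add: sum.union_disjoint)
      also have "\<dots> = (\<Sum>j<n. stiffness (p i) (p j) * (L $ l \<bullet> p j + v $ l))"
        using \<open>i < n\<close> by (simp add: A r)
      also have "\<dots> = (\<Sum>u\<in>mesh_vertices \<T>. stiffness (p i) u * (L $ l \<bullet> u + v $ l))"
        using assms(3) by (rule sum.reindex_bij_betw)
      also have "\<dots> = 0" by (rule stiffness_affine[OF p[OF \<open>i < n\<close>] interior[OF i]])
      finally have "(\<Sum>j\<in>?I. ?A $$ (i, j) * r j $ l) = - (\<Sum>j\<in>?B. ?A $$ (i, j) * q j $ l)"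
        using q(1) by (simp add: r_def)
      then show "(\<Sum>j\<in>?I. ?A $$ (i, j) * (q j - r j) $ l) = 0"
        using femwarp_solution_rows[OF q(2) i, of l]
        by (simp add: right_diff_distrib sum_subtractf)
    qed (rule i)
    then show ?thesis by (simp add: Finite_Cartesian_Product.vec_eq_iff r_def)
  qed
  ultimately show ?thesis by blast
qed

end
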